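(* The two-dimensional Mordell-Gruber spectrum $\mathrm{MG}_2$ is a closed set.
   Context: A unimodular lattice in $\mathbb{R}^2$ is $\Lambda=\mathbb{Z}A+\mathbb{Z}B$ with $|\det(A;B)|=1$. A rectangle $[-x,x]\times[-y,y]$ ($x,y>0$) is admissible in $\Lambda$ if its only point in $\Lambda$ is $(0,0)$; the Mordell constant is $\kappa(\Lambda)=\sup xy$ over all admissible rectangles, and $\mathrm{MG}_2=\{\kappa(\Lambda):\Lambda\text{ a unimodular lattice in }\mathbb{R}^2\}\subset\mathbb{R}$. *)

theory Defs
  imports "HOL-Analysis.Analysis"
begin

definition lattice_of :: "real^2 \<Rightarrow> real^2 \<Rightarrow> (real^2) set" where
  "lattice_of A B = {of_int m *\<^sub>R A + of_int n *\<^sub>R B | m n :: int. True}"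

definition unimodular_lattice :: "(real^2) set \<Rightarrow> bool" where
  "unimodular_lattice \<Lambda> \<longleftrightarrow>
     (\<exists>A B. \<Lambda> = lattice_of A B \<and> \<bar>det (vector [A, B] :: real^2^2)\<bar> = 1)"

definition rectangle :: "real \<Rightarrow> real \<Rightarrow> (real^2) set" where
  "rectangle x y = {P. P $ 1 \<in> {-x..x} \<and> P $ 2 \<in> {-y..y}}"

definition admissible :: "(real^2) set \<Rightarrow> real \<Rightarrow> real \<Rightarrow> bool" where
  "admissible \<Lambda> x y \<longleftrightarrow> x > 0 \<and> y > 0 \<and> rectangle x y \<inter> \<Lambda> = {0}"

text \<open>For a unimodular lattice the set below is nonempty (the lattice is discrete) and
  bounded above by 1 (Minkowski's convex body theorem), so \<^const>\<open>Sup\<close> on the reals is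
  the genuine supremum.\<close>

definition mordell_constant :: "(real^2) set \<Rightarrow> real" where
  "mordell_constant \<Lambda> = Sup {x * y | x y. admissible \<Lambda> x y}"

definition MG2 :: "real set" where
  "MG2 = {mordell_constant \<Lambda> | \<Lambda>. unimodular_lattice \<Lambda>}"

end

theory Submission
  imports Defs
begin

text \<open>
  The Mordell constant \<open>\<kappa>\<close> is invariant under the hyperbolic scalings \<open>(a, b) \<mapsto> (t a, b / t)\<close>, and
  lower semicontinuous in the lattice: an admissible rectangle is compact, so it stays admissible
  under small perturbations of a basis.
  Semicontinuity alone lets \<open>\<kappa>\<close> drop in a limit. The scalings repair this.

  Let \<open>\<kappa>(\<Lambda>\<^sub>n) \<rightarrow> l\<close>. Scale each \<open>\<Lambda>\<^sub>n\<close> so that an almost optimal admissible rectangle becomes a square of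
  half-side \<open>s\<^sub>n\<close>, so \<open>s\<^sub>n\<^sup>2 \<rightarrow> l\<close>. Since \<open>\<kappa>\<close> is bounded below by a positive constant
  (\<open>admissible_rectangle_of_area\<close>), these squares are not small, the scaled lattices have no short
  vectors, and Lagrange reduction gives them bases in a fixed bounded set
  (\<open>reduced_basis\<close>). This is the planar case of Mahler's compactness theorem. Pass to a convergent
  subsequence of bases, with limit lattice \<open>\<Lambda>\<close>. The open square of half-side
  \<open>sqrt l\<close> contains no nonzero point of \<open>\<Lambda>\<close>, whence \<open>\<kappa>(\<Lambda>) \<ge> l\<close>; semicontinuity
  (\<open>eventually_admissible\<close>) gives \<open>\<kappa>(\<Lambda>) \<le> l\<close>. So \<open>l\<close> is attained.
\<close>

section \<open>Unimodular bases\<close>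

definition cross2 :: "real^2 \<Rightarrow> real^2 \<Rightarrow> real" where
  "cross2 A B = A $ 1 * B $ 2 - A $ 2 * B $ 1"

lemma det_rows_eq_cross2: "det (vector [A, B] :: real^2^2) = cross2 A B"
  by (simp add: det_2 cross2_def)

lemma vec2_eq_iff: "(A :: real^2) = B \<longleftrightarrow> A $ 1 = B $ 1 \<and> A $ 2 = B $ 2"
  by (simp add: vec_eq_iff forall_2)

lemma unimodular_lattice_iff:
  "unimodular_lattice \<Lambda> \<longleftrightarrow> (\<exists>A B. \<Lambda> = lattice_of A B \<and> \<bar>cross2 A B\<bar> = 1)"
  by (simp add: unimodular_lattice_def det_rows_eq_cross2)

lemma cross2_combination:
  "cross2 (of_int m *\<^sub>R A + of_int n *\<^sub>R B) (of_int p *\<^sub>R A + of_int q *\<^sub>R B)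
     = of_int (m * q - n * p) * cross2 A B"
  by (simp add: cross2_def algebra_simps)

lemma cross2_combination_left:
  "cross2 (of_int m *\<^sub>R A + of_int n *\<^sub>R B) B = of_int m * cross2 A B"
  by (simp add: cross2_def algebra_simps)

lemma cross2_combination_right:
  "cross2 A (of_int m *\<^sub>R A + of_int n *\<^sub>R B) = of_int n * cross2 A B"
  by (simp add: cross2_def algebra_simps)

lemma combination_eq_0_iff:
  assumes "\<bar>cross2 A B\<bar> = 1"
  shows "of_int m *\<^sub>R A + of_int n *\<^sub>R B = 0 \<longleftrightarrow> m = 0 \<and> n = 0"
proof
  assume 0: "of_int m *\<^sub>R A + of_int n *\<^sub>R B = 0"
  have "cross2 A B \<noteq> 0" using assms by auto
  then show "m = 0 \<and> n = 0"
    using cross2_combination_left[of m A n B] cross2_combination_right[of A m n B] 0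
    by (auto simp: cross2_def)
qed simp

lemma combination_in_lattice_of: "of_int m *\<^sub>R A + of_int n *\<^sub>R B \<in> lattice_of A B"
  by (auto simp: lattice_of_def)

lemma zero_in_lattice_of: "0 \<in> lattice_of A B"
  using combination_in_lattice_of[of 0 A 0 B] by simp

lemma basis_in_lattice_of: "A \<in> lattice_of A B"
  using combination_in_lattice_of[of 1 A 0 B] by simp

lemma lattice_of_swap: "lattice_of B A = lattice_of A B"
  unfolding lattice_of_def by (metis (no_types, opaque_lifting) add.commute)

lemma lattice_of_shear: "lattice_of A (B + of_int k *\<^sub>R A) = lattice_of A B"
proof (intro equalityI subsetI)
  fix P assume "P \<in> lattice_of A (B + of_int k *\<^sub>R A)"
  then obtain m n where "P = of_int m *\<^sub>R A + of_int n *\<^sub>R (B + of_int k *\<^sub>R A)"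
    by (auto simp: lattice_of_def)
  then have "P = of_int (m + n * k) *\<^sub>R A + of_int n *\<^sub>R B"
    by (simp add: algebra_simps)
  then show "P \<in> lattice_of A B" by (simp only: combination_in_lattice_of)
next
  fix P assume "P \<in> lattice_of A B"
  then obtain m n where "P = of_int m *\<^sub>R A + of_int n *\<^sub>R B"
    by (auto simp: lattice_of_def)
  then have "P = of_int (m - n * k) *\<^sub>R A + of_int n *\<^sub>R (B + of_int k *\<^sub>R A)"
    by (simp add: algebra_simps)
  then show "P \<in> lattice_of A (B + of_int k *\<^sub>R A)" by (simp only: combination_in_lattice_of)
qed

lemma basis_nonzero:
  assumes "\<bar>cross2 A B\<bar> = 1" shows "A \<noteq> 0"
  using assms by (auto simp: cross2_def)

lemma admissible_iff:
  "admissible (lattice_of A B) x y \<longleftrightarrow> x > 0 \<and> y > 0 \<and>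
    (\<forall>P \<in> lattice_of A B. P \<noteq> 0 \<longrightarrow> \<bar>P $ 1\<bar> > x \<or> \<bar>P $ 2\<bar> > y)"
proof (cases "x > 0 \<and> y > 0")
  case True
  then have "0 \<in> rectangle x y \<inter> lattice_of A B"
    using zero_in_lattice_of[of A B] by (simp add: rectangle_def)
  then have "rectangle x y \<inter> lattice_of A B = {0} \<longleftrightarrow>
      (\<forall>P \<in> lattice_of A B. P \<noteq> 0 \<longrightarrow> P \<notin> rectangle x y)"
    by blast
  moreover have "P \<notin> rectangle x y \<longleftrightarrow> \<bar>P $ 1\<bar> > x \<or> \<bar>P $ 2\<bar> > y" for P
    by (auto simp: rectangle_def)
  ultimately show ?thesis using True by (simp add: admissible_def)
qed (auto simp: admissible_def)

section \<open>Lagrange reduction\<close>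

lemma lagrange_identity2: "(A \<bullet> B)\<^sup>2 + (cross2 A B)\<^sup>2 = (A \<bullet> A) * (B \<bullet> B)" for A B :: "real^2"
  by (simp add: inner_vec_def sum_2 cross2_def power2_eq_square algebra_simps)

text \<open>Instead of a shortest vector, take a basis vector \<open>A\<close> whose square is within a factor \<open>3/2\<close> of the
  infimum over all bases; the lower bound \<open>s\<close> keeps this infimum positive. A second vector
  \<open>B\<close>, size-reduced against \<open>A\<close>, competes for the same infimum, so \<open>\<bar>B\<bar>\<^sup>2 > 2/3 \<bar>A\<bar>\<^sup>2\<close>. Two nearly
  orthogonal vectors of comparable length spanning area 1 cannot be long.\<close>

lemma reduced_basis:
  assumes det: "\<bar>cross2 A0 B0\<bar> = 1" and "s > 0"
    and long: "\<And>P. P \<in> lattice_of A0 B0 \<Longrightarrow> P \<noteq> 0 \<Longrightarrow> s \<le> P \<bullet> P"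
  obtains A B where "lattice_of A B = lattice_of A0 B0" "\<bar>cross2 A B\<bar> = 1"
    "(A \<bullet> A)\<^sup>2 < 12/5" "(A \<bullet> A) * (B \<bullet> B) \<le> 1 + (A \<bullet> A)\<^sup>2 / 4"
proof -
  define S where "S = {A \<bullet> A | A B. lattice_of A B = lattice_of A0 B0 \<and> \<bar>cross2 A B\<bar> = 1}"
  have ne: "S \<noteq> {}" using det by (auto simp: S_def)
  have lb: "s \<le> z" if "z \<in> S" for z
  proof -
    obtain A B where "z = A \<bullet> A" "lattice_of A B = lattice_of A0 B0" "\<bar>cross2 A B\<bar> = 1"
      using \<open>z \<in> S\<close> by (auto simp: S_def)
    then show ?thesis
      using long[of A] basis_in_lattice_of[of A B] basis_nonzero[of A B] by auto
  qed
  then have "bdd_below S" by (rule bdd_belowI)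
  have "s \<le> Inf S" using ne lb by (rule cInf_greatest)
  then have "Inf S < 3/2 * Inf S" using \<open>s > 0\<close> by linarith
  then obtain z where "z \<in> S" "z < 3/2 * Inf S"
    using cInf_lessD[OF ne] by blast
  then obtain A B where AB: "lattice_of A B = lattice_of A0 B0" "\<bar>cross2 A B\<bar> = 1"
    and A: "A \<bullet> A < 3/2 * Inf S" by (auto simp: S_def)
  have A0: "A \<bullet> A > 0" using basis_nonzero[OF AB(2)] by simp
  define k where "k = - round ((A \<bullet> B) / (A \<bullet> A))"
  define B' where "B' = B + of_int k *\<^sub>R A"
  have "A \<bullet> B' = (A \<bullet> A) * ((A \<bullet> B) / (A \<bullet> A) - of_int (round ((A \<bullet> B) / (A \<bullet> A))))"
    using A0 by (simp add: B'_def k_def inner_add_right inner_diff_right right_diff_distrib)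
  moreover have "\<bar>(A \<bullet> B) / (A \<bullet> A) - of_int (round ((A \<bullet> B) / (A \<bullet> A)))\<bar> \<le> 1/2"
    using of_int_round_abs_le[of "(A \<bullet> B) / (A \<bullet> A)"] by (simp add: abs_minus_commute)
  ultimately have "\<bar>A \<bullet> B'\<bar> \<le> (A \<bullet> A) * (1/2)"
    using A0 by (simp add: abs_mult mult_left_mono)
  then have ip: "(A \<bullet> B')\<^sup>2 \<le> (A \<bullet> A)\<^sup>2 / 4"
    using power_mono[of "\<bar>A \<bullet> B'\<bar>" "(A \<bullet> A) * (1/2)" 2] by (simp add: power_divide)
  have c: "cross2 A B' = cross2 A B" by (simp add: B'_def cross2_def algebra_simps)
  have sq1: "(cross2 A B')\<^sup>2 = 1" using AB(2) c by (metis abs_1 power2_abs power_one)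
  have L: "lattice_of A B' = lattice_of A0 B0"
    using AB(1) by (simp add: B'_def lattice_of_shear)
  have bound: "(A \<bullet> A) * (B' \<bullet> B') \<le> 1 + (A \<bullet> A)\<^sup>2 / 4"
    using lagrange_identity2[of A B'] ip sq1 by linarith
  have "\<bar>cross2 B' A\<bar> = 1" using AB(2) c by (simp add: cross2_def abs_if algebra_simps split: if_splits)
  then have "B' \<bullet> B' \<in> S" using L lattice_of_swap unfolding S_def by blast
  then have "Inf S \<le> B' \<bullet> B'" using \<open>bdd_below S\<close> by (rule cInf_lower)
  then have "2/3 * (A \<bullet> A) < B' \<bullet> B'" using A by linarith
  then have "(A \<bullet> A) * (2/3 * (A \<bullet> A)) < (A \<bullet> A) * (B' \<bullet> B')"
    using A0 by (intro mult_strict_left_mono) auto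
  then have "(A \<bullet> A)\<^sup>2 < 12/5" using bound by (simp add: power2_eq_square)
  with that[of A B'] L AB(2) c bound show ?thesis by simp
qed

section \<open>Hyperbolic scalings\<close>

definition hscale :: "real \<Rightarrow> real^2 \<Rightarrow> real^2" where
  "hscale t P = vector [t * P $ 1, P $ 2 / t]"

lemma hscale_nth [simp]: "hscale t P $ 1 = t * P $ 1" "hscale t P $ 2 = P $ 2 / t"
  by (simp_all add: hscale_def)

lemma cross2_hscale: "t > 0 \<Longrightarrow> cross2 (hscale t A) (hscale t B) = cross2 A B"
  by (simp add: cross2_def)

lemma hscale_combination:
  "of_int m *\<^sub>R hscale t A + of_int n *\<^sub>R hscale t B = hscale t (of_int m *\<^sub>R A + of_int n *\<^sub>R B)"
  by (simp add: vec2_eq_iff algebra_simps add_divide_distrib)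

lemma lattice_of_hscale: "lattice_of (hscale t A) (hscale t B) = hscale t ` lattice_of A B"
  unfolding lattice_of_def hscale_combination by auto

lemma admissible_hscale:
  assumes "t > 0"
  shows "admissible (lattice_of (hscale t A) (hscale t B)) x y
     \<longleftrightarrow> admissible (lattice_of A B) (x / t) (y * t)"
proof -
  have "hscale t P = 0 \<longleftrightarrow> P = 0" for P
    using \<open>t > 0\<close> by (simp add: vec2_eq_iff)
  moreover have "x > 0 \<longleftrightarrow> x / t > 0" "y > 0 \<longleftrightarrow> y * t > 0"
    using \<open>t > 0\<close> by (simp_all add: zero_less_divide_iff zero_less_mult_iff)
  moreover have "\<bar>t * P $ 1\<bar> > x \<longleftrightarrow> \<bar>P $ 1\<bar> > x / t" "\<bar>P $ 2 / t\<bar> > y \<longleftrightarrow> \<bar>P $ 2\<bar> > y * t"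
    for P :: "real^2"
    using \<open>t > 0\<close> by (simp_all add: abs_mult field_simps)
  ultimately show ?thesis
    unfolding admissible_iff unfolding lattice_of_hscale by (simp del: abs_divide)
qed

lemma mordell_constant_hscale:
  assumes "t > 0"
  shows "mordell_constant (lattice_of (hscale t A) (hscale t B)) = mordell_constant (lattice_of A B)"
proof -
  have "{x * y | x y. admissible (lattice_of (hscale t A) (hscale t B)) x y}
      = {x * y | x y. admissible (lattice_of A B) x y}" (is "?L = ?R")
  proof (intro equalityI subsetI)
    fix z assume "z \<in> ?L"
    then obtain x y where "z = (x / t) * (y * t)" "admissible (lattice_of A B) (x / t) (y * t)"
      using admissible_hscale[OF assms] assms by auto
    then show "z \<in> ?R" by blast
  next
    fix z assume "z \<in> ?R"
    then obtain x y where "z = x * y" "admissible (lattice_of A B) x y" by auto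
    then have "z = (x * t) * (y / t)"
      "admissible (lattice_of (hscale t A) (hscale t B)) (x * t) (y / t)"
      using admissible_hscale[OF assms] assms by auto
    then show "z \<in> ?L" by blast
  qed
  then show ?thesis by (simp add: mordell_constant_def)
qed

text \<open>Every rectangle is a scaled square, and an admissible square of half-side \<open>s\<close> leaves no nonzero
  lattice vector shorter than \<open>s\<close>, which is what basis reduction asks for. The inequalities on \<open>A\<close> serve
  twice: they bound the bases of the scaled lattices, and together they bound the area \<open>x y\<close>.\<close>

lemma square_normalization:
  assumes det: "\<bar>cross2 A0 B0\<bar> = 1" and adm: "admissible (lattice_of A0 B0) x y"
  obtains A B where "\<bar>cross2 A B\<bar> = 1"
    "mordell_constant (lattice_of A B) = mordell_constant (lattice_of A0 B0)"
    "admissible (lattice_of A B) (sqrt (x * y)) (sqrt (x * y))"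
    "x * y \<le> A \<bullet> A" "A \<bullet> A < 2" "x * y * (B \<bullet> B) \<le> 2"
proof -
  have xy: "x > 0" "y > 0" using adm by (auto simp: admissible_def)
  define t where "t = sqrt (y / x)"
  define s where "s = sqrt (x * y)"
  have t: "t > 0" and s: "s > 0" using xy by (auto simp: t_def s_def)
  have s2: "s * s = x * y" using xy by (simp add: s_def)
  have "s / t = x" "s * t = y"
    using xy by (simp_all add: s_def t_def real_sqrt_mult real_sqrt_divide field_simps)
  define A1 B1 where "A1 = hscale t A0" and "B1 = hscale t B0"
  have det1: "\<bar>cross2 A1 B1\<bar> = 1" using det t by (simp add: A1_def B1_def cross2_hscale)
  have adm1: "admissible (lattice_of A1 B1) s s"
    using adm \<open>s / t = x\<close> \<open>s * t = y\<close> by (simp add: A1_def B1_def admissible_hscale t)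
  have long: "x * y \<le> P \<bullet> P" if P: "P \<in> lattice_of A1 B1" "P \<noteq> 0" for P
  proof -
    have "\<bar>P $ 1\<bar> > s \<or> \<bar>P $ 2\<bar> > s" using adm1 P by (simp add: admissible_iff)
    then have "s * s \<le> P $ 1 * P $ 1 \<or> s * s \<le> P $ 2 * P $ 2"
      using s abs_mult_self_eq[of "P $ 1"] abs_mult_self_eq[of "P $ 2"]
      by (metis less_imp_le mult_mono abs_ge_zero)
    then have "s * s \<le> P $ 1 * P $ 1 + P $ 2 * P $ 2"
      using zero_le_square[of "P $ 1"] zero_le_square[of "P $ 2"] by linarith
    then show ?thesis using s2 by (simp add: inner_vec_def sum_2)
  qed
  have "x * y > 0" using xy by simp
  then obtain A B where AB: "lattice_of A B = lattice_of A1 B1" "\<bar>cross2 A B\<bar> = 1"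
    "(A \<bullet> A)\<^sup>2 < 12/5" "(A \<bullet> A) * (B \<bullet> B) \<le> 1 + (A \<bullet> A)\<^sup>2 / 4"
    using reduced_basis[OF det1 _ long] by blast
  have lA: "x * y \<le> A \<bullet> A"
    using long[of A] basis_in_lattice_of[of A B] basis_nonzero[OF AB(2)] AB(1) by simp
  have "A \<bullet> A < 2"
  proof (rule ccontr)
    assume "\<not> A \<bullet> A < 2"
    then have "2\<^sup>2 \<le> (A \<bullet> A)\<^sup>2" by (intro power_mono) auto
    then show False using AB(3) by simp
  qed
  moreover have "x * y * (B \<bullet> B) \<le> (A \<bullet> A) * (B \<bullet> B)"
    using lA by (intro mult_right_mono) auto
  then have "x * y * (B \<bullet> B) \<le> 2" using AB(3,4) by linarith
  moreover have "mordell_constant (lattice_of A B) = mordell_constant (lattice_of A0 B0)"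
    using AB(1) mordell_constant_hscale[OF t] by (simp add: A1_def B1_def)
  ultimately show ?thesis using that[of A B] AB lA adm1 by (simp add: s_def)
qed

section \<open>Bounds for the Mordell constant\<close>

lemma admissible_area_less_2:
  assumes "\<bar>cross2 A B\<bar> = 1" "admissible (lattice_of A B) x y"
  shows "x * y < 2"
  using square_normalization[OF assms] by (metis le_less_trans)

lemma bdd_above_admissible_areas:
  assumes "\<bar>cross2 A B\<bar> = 1"
  shows "bdd_above {x * y | x y. admissible (lattice_of A B) x y}"
  using admissible_area_less_2[OF assms] by (fastforce intro: bdd_aboveI[of _ 2])

lemma admissible_area_le_mordell_constant:
  assumes "\<bar>cross2 A B\<bar> = 1" "admissible (lattice_of A B) x y"
  shows "x * y \<le> mordell_constant (lattice_of A B)"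
  unfolding mordell_constant_def
  using bdd_above_admissible_areas[OF assms(1)] assms(2) by (intro cSup_upper) auto

text \<open>The inequality \<open>\<bar>a\<bar> y + \<bar>b\<bar> x < 1\<close> forces every lattice point of the rectangle to have integer
  cross product of modulus less than 1 with the primitive vector \<open>V = (a, b)\<close>. So it is an
  integer multiple of \<open>V\<close>, and \<open>V\<close> itself sticks out of the rectangle.\<close>

lemma admissible_beside_primitive_vector:
  assumes det: "\<bar>cross2 A B\<bar> = 1" and "coprime m n"
    and V: "V = of_int m *\<^sub>R A + of_int n *\<^sub>R B"
    and xy: "x > 0" "y > 0" and small: "\<bar>V $ 1\<bar> * y + \<bar>V $ 2\<bar> * x < 1"
    and out: "x < \<bar>V $ 1\<bar> \<or> y < \<bar>V $ 2\<bar>"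
  shows "admissible (lattice_of A B) x y"
proof -
  have "\<bar>W $ 1\<bar> > x \<or> \<bar>W $ 2\<bar> > y" if W: "W \<in> lattice_of A B" "W \<noteq> 0" for W
  proof (rule ccontr)
    assume "\<not> ?thesis"
    then have in_rect: "\<bar>W $ 1\<bar> \<le> x" "\<bar>W $ 2\<bar> \<le> y" by auto
    obtain p q where pq: "W = of_int p *\<^sub>R A + of_int q *\<^sub>R B"
      using W by (auto simp: lattice_of_def)
    have "\<bar>cross2 V W\<bar> \<le> \<bar>V $ 1\<bar> * \<bar>W $ 2\<bar> + \<bar>V $ 2\<bar> * \<bar>W $ 1\<bar>"
      unfolding cross2_def by (simp add: abs_mult[symmetric])
    also have "\<dots> \<le> \<bar>V $ 1\<bar> * y + \<bar>V $ 2\<bar> * x"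
      using in_rect by (intro add_mono mult_left_mono) auto
    also have "\<dots> < 1" by (rule small)
    finally have "\<bar>of_int (m * q - n * p) :: real\<bar> < 1"
      unfolding V pq cross2_combination by (simp add: abs_mult det)
    then have eq: "m * q = n * p" by linarith
    obtain u v where uv: "u * m + v * n = 1"
      using bezout_int[of m n] \<open>coprime m n\<close> by auto
    define k where "k = u * p + v * q"
    have "k * m = u * m * p + v * (m * q)" "k * n = u * (n * p) + v * n * q"
      by (simp_all add: k_def algebra_simps)
    then have "k * m = (u * m + v * n) * p" "k * n = (u * m + v * n) * q"
      unfolding eq[symmetric] by (simp_all add: eq algebra_simps)
    then have "p = k * m" "q = k * n" using uv by auto
    then have "W = of_int k *\<^sub>R V" by (simp add: V pq algebra_simps)
    moreover have "k \<noteq> 0" using calculation W by auto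
    then have "1 \<le> \<bar>of_int k :: real\<bar>" by linarith
    ultimately have "\<bar>V $ 1\<bar> \<le> \<bar>W $ 1\<bar>" "\<bar>V $ 2\<bar> \<le> \<bar>W $ 2\<bar>"
      using mult_right_mono[of 1 "\<bar>of_int k :: real\<bar>"] by (fastforce simp: abs_mult)+
    then show False using in_rect out by linarith
  qed
  then show ?thesis using xy by (simp add: admissible_iff)
qed

text \<open>If the square of half-side \<open>1/2\<close> is not admissible, it contains a primitive vector, and a
  rectangle just avoiding that vector on one side can be taken long on the other.\<close>

lemma admissible_rectangle_of_area:
  assumes det: "\<bar>cross2 A B\<bar> = 1"
  obtains x y where "admissible (lattice_of A B) x y" "x * y \<ge> 1/8"
proof (cases "admissible (lattice_of A B) (1/2) (1/2)")
  case True
  then show ?thesis using that by force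
next
  case False
  then obtain P where P: "P \<in> lattice_of A B" "P \<noteq> 0" "\<bar>P $ 1\<bar> \<le> 1/2" "\<bar>P $ 2\<bar> \<le> 1/2"
    by (auto simp: admissible_iff not_less)
  obtain p q where pq: "P = of_int p *\<^sub>R A + of_int q *\<^sub>R B"
    using P by (auto simp: lattice_of_def)
  then have "p \<noteq> 0 \<or> q \<noteq> 0" using P(2) by auto
  define g where "g = gcd p q"
  obtain m n where mn: "p = g * m" "q = g * n" "coprime m n"
    using gcd_coprime_exists[of p q] \<open>p \<noteq> 0 \<or> q \<noteq> 0\<close> unfolding g_def
    by (metis gcd_eq_0_iff mult.commute)
  have "g \<ge> 1" using \<open>p \<noteq> 0 \<or> q \<noteq> 0\<close> unfolding g_def
    by (metis gcd_eq_0_iff gcd_ge_0_int int_one_le_iff_zero_less order_le_less)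
  define V where "V = of_int m *\<^sub>R A + of_int n *\<^sub>R B"
  have PV: "P = of_int g *\<^sub>R V" by (simp add: pq V_def mn algebra_simps)
  have "\<bar>V $ i\<bar> \<le> \<bar>P $ i\<bar>" for i
    using mult_right_mono[of 1 "of_int g :: real" "\<bar>V $ i\<bar>"] \<open>g \<ge> 1\<close> by (simp add: PV abs_mult)
  then have V: "\<bar>V $ 1\<bar> \<le> 1/2" "\<bar>V $ 2\<bar> \<le> 1/2" using P order_trans by blast+
  have "V \<noteq> 0" using P PV by auto
  then consider "V $ 2 \<noteq> 0" | "V $ 1 \<noteq> 0" "V $ 2 = 0" by (auto simp: vec2_eq_iff)
  then show ?thesis
  proof cases
    case 1
    define b where "b = \<bar>V $ 2\<bar>"
    have b: "b > 0" "b \<le> 1/2" using 1 V by (auto simp: b_def)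
    have "\<bar>V $ 1\<bar> * (b / 2) \<le> 1/2 * (b / 2)" using V b by (intro mult_right_mono) auto
    moreover have "b * (1 / (4 * b)) = 1/4" using b by simp
    ultimately have "\<bar>V $ 1\<bar> * (b / 2) + b * (1 / (4 * b)) < 1" using b by linarith
    then have "admissible (lattice_of A B) (1 / (4 * b)) (b / 2)"
      using b by (intro admissible_beside_primitive_vector[OF det mn(3) V_def]) (auto simp: b_def)
    then show ?thesis using that[of "1 / (4 * b)" "b / 2"] b by simp
  next
    case 2
    define a where "a = \<bar>V $ 1\<bar>"
    have a: "a > 0" using 2 by (simp add: a_def)
    then have "admissible (lattice_of A B) (a / 2) (1 / (4 * a))"
      using 2 by (intro admissible_beside_primitive_vector[OF det mn(3) V_def]) (auto simp: a_def)
    then show ?thesis using that[of "a / 2" "1 / (4 * a)"] a by simp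
  qed
qed

section \<open>Convergent sequences of lattices\<close>

lemma abs_cross2_le_norm: "\<bar>cross2 A B\<bar> \<le> norm A * norm B"
proof -
  have "(cross2 A B)\<^sup>2 \<le> (norm A * norm B)\<^sup>2"
    using lagrange_identity2[of A B] by (simp add: power_mult_distrib power2_norm_eq_inner)
      (metis le_add_same_cancel2 zero_le_power2)
  then show ?thesis by (simp add: abs_le_square_iff[symmetric])
qed

lemma tendsto_cross2:
  assumes "(f \<longlongrightarrow> A) F" "(g \<longlongrightarrow> B) F"
  shows "((\<lambda>k. cross2 (f k) (g k)) \<longlongrightarrow> cross2 A B) F"
  unfolding cross2_def by (intro tendsto_intros assms)

lemma tendsto_combination:
  fixes f g :: "nat \<Rightarrow> real^2"
  assumes "f \<longlonglongrightarrow> A" "g \<longlonglongrightarrow> B"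
  shows "(\<lambda>k. of_int m *\<^sub>R f k + of_int n *\<^sub>R g k) \<longlonglongrightarrow> of_int m *\<^sub>R A + of_int n *\<^sub>R B"
  by (intro tendsto_intros assms)

text \<open>Lower semicontinuity of the Mordell constant. The coefficients of a lattice point are its
  cross products with the basis, so points of a fixed rectangle have uniformly bounded coefficients
  and only finitely many coefficient pairs matter; each of them leaves the closed rectangle in an
  open manner.\<close>

lemma eventually_admissible:
  assumes f: "f \<longlonglongrightarrow> A" and g: "g \<longlonglongrightarrow> B"
    and det: "\<And>k. \<bar>cross2 (f k) (g k)\<bar> = 1" "\<bar>cross2 A B\<bar> = 1"
    and bound: "\<And>k. norm (f k) \<le> C" "\<And>k. norm (g k) \<le> C"
    and adm: "admissible (lattice_of A B) x y"
  shows "\<forall>\<^sub>F k in sequentially. admissible (lattice_of (f k) (g k)) x y"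
proof -
  have xy: "x > 0" "y > 0" using adm by (auto simp: admissible_def)
  define N where "N = \<lceil>(x + y) * C\<rceil>"
  define I where "I = {-N..N} \<times> {-N..N} - {(0, 0)}"
  have C: "C \<ge> 0" using bound(1)[of 0] norm_ge_zero order_trans by blast
  have "\<forall>i\<in>I. \<forall>\<^sub>F k in sequentially.
      \<bar>(of_int (fst i) *\<^sub>R f k + of_int (snd i) *\<^sub>R g k) $ 1\<bar> > x \<or>
      \<bar>(of_int (fst i) *\<^sub>R f k + of_int (snd i) *\<^sub>R g k) $ 2\<bar> > y" (is "\<forall>i\<in>I. ?E i")
  proof
    fix i assume "i \<in> I"
    define P where "P = of_int (fst i) *\<^sub>R A + of_int (snd i) *\<^sub>R B"
    have "P \<noteq> 0" using combination_eq_0_iff[OF det(2)] \<open>i \<in> I\<close> by (auto simp: P_def I_def)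
    then have "\<bar>P $ 1\<bar> > x \<or> \<bar>P $ 2\<bar> > y"
      using adm combination_in_lattice_of by (auto simp: admissible_iff P_def)
    moreover have "(\<lambda>k. \<bar>(of_int (fst i) *\<^sub>R f k + of_int (snd i) *\<^sub>R g k) $ j\<bar>) \<longlonglongrightarrow> \<bar>P $ j\<bar>" for j
      unfolding P_def by (intro tendsto_rabs tendsto_vec_nth tendsto_combination f g)
    ultimately show "?E i"
      by (auto intro: eventually_mono[OF order_tendstoD(1)])
  qed
  moreover have "finite I" by (simp add: I_def)
  ultimately have "\<forall>\<^sub>F k in sequentially. \<forall>i\<in>I.
      \<bar>(of_int (fst i) *\<^sub>R f k + of_int (snd i) *\<^sub>R g k) $ 1\<bar> > x \<or>
      \<bar>(of_int (fst i) *\<^sub>R f k + of_int (snd i) *\<^sub>R g k) $ 2\<bar> > y"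
    by (rule eventually_ball_finite[rotated])
  then show ?thesis
  proof eventually_elim
    case (elim k)
    have "\<bar>P $ 1\<bar> > x \<or> \<bar>P $ 2\<bar> > y" if P: "P \<in> lattice_of (f k) (g k)" "P \<noteq> 0" for P
    proof (rule ccontr)
      assume "\<not> ?thesis"
      then have in_rect: "\<bar>P $ 1\<bar> \<le> x" "\<bar>P $ 2\<bar> \<le> y" by auto
      obtain m n where mn: "P = of_int m *\<^sub>R f k + of_int n *\<^sub>R g k"
        using P by (auto simp: lattice_of_def)
      have "norm P \<le> x + y"
        using norm_le_l1_cart[of P] in_rect by (simp add: sum_2)
      have "\<bar>of_int m :: real\<bar> \<le> norm P * norm (g k)"
        using abs_cross2_le_norm[of P "g k"] det(1)
        unfolding mn cross2_combination_left by (simp add: abs_mult)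
      also have "\<dots> \<le> (x + y) * C"
        using \<open>norm P \<le> x + y\<close> bound xy by (intro mult_mono) auto
      finally have m: "\<bar>m\<bar> \<le> N" unfolding N_def by linarith
      have "\<bar>of_int n :: real\<bar> \<le> norm P * norm (f k)"
        using abs_cross2_le_norm[of "f k" P] det(1)
        unfolding mn cross2_combination_right by (simp add: abs_mult mult.commute)
      also have "\<dots> \<le> (x + y) * C"
        using \<open>norm P \<le> x + y\<close> bound xy by (intro mult_mono) auto
      finally have n: "\<bar>n\<bar> \<le> N" unfolding N_def by linarith
      have "(m, n) \<in> I" using m n P(2) mn by (auto simp: I_def)
      then show False using elim in_rect unfolding mn by fastforce
    qed
    then show ?case using xy by (simp add: admissible_iff)
  qed
qed

text \<open>A lattice point in the limiting square is approached by points with the same coefficients,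
  which would eventually lie in the admissible squares. The strict inequality \<open>r < s\<close> is what
  keeps the approximants inside.\<close>

lemma admissible_square_limit:
  assumes f: "f \<longlonglongrightarrow> A" and g: "g \<longlonglongrightarrow> B"
    and det: "\<And>k. \<bar>cross2 (f k) (g k)\<bar> = 1"
    and adm: "\<And>k. admissible (lattice_of (f k) (g k)) (\<sigma> k) (\<sigma> k)"
    and \<sigma>: "\<sigma> \<longlonglongrightarrow> s" and r: "0 < r" "r < s"
  shows "admissible (lattice_of A B) r r"
proof -
  have "\<bar>P $ 1\<bar> > r \<or> \<bar>P $ 2\<bar> > r" if P: "P \<in> lattice_of A B" "P \<noteq> 0" for P
  proof (rule ccontr)
    assume "\<not> ?thesis"
    then have in_square: "\<bar>P $ 1\<bar> < s" "\<bar>P $ 2\<bar> < s" using r by auto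
    obtain m n where mn: "P = of_int m *\<^sub>R A + of_int n *\<^sub>R B"
      using P by (auto simp: lattice_of_def)
    define Q where "Q k = of_int m *\<^sub>R f k + of_int n *\<^sub>R g k" for k
    have lim: "(\<lambda>k. \<sigma> k - \<bar>Q k $ j\<bar>) \<longlonglongrightarrow> s - \<bar>P $ j\<bar>" for j
      unfolding Q_def mn
      by (intro tendsto_diff \<sigma> tendsto_rabs tendsto_vec_nth tendsto_combination f g)
    have "\<forall>\<^sub>F k in sequentially. \<sigma> k - \<bar>Q k $ 1\<bar> > 0"
      "\<forall>\<^sub>F k in sequentially. \<sigma> k - \<bar>Q k $ 2\<bar> > 0"
      by (rule order_tendstoD(1)[OF lim]; use in_square in simp)+
    then have "\<forall>\<^sub>F k in sequentially. \<sigma> k - \<bar>Q k $ 1\<bar> > 0 \<and> \<sigma> k - \<bar>Q k $ 2\<bar> > 0"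
      by (rule eventually_conj)
    then obtain k where k: "\<bar>Q k $ 1\<bar> < \<sigma> k" "\<bar>Q k $ 2\<bar> < \<sigma> k"
      by (auto simp: eventually_sequentially)
    have "Q k \<noteq> 0"
      using P(2) mn combination_eq_0_iff[OF det[of k], of m n] by (auto simp: Q_def)
    then show False
      using adm[of k] k combination_in_lattice_of[of m "f k" n "g k"]
      by (force simp: admissible_iff Q_def)
  qed
  then show ?thesis using r by (simp add: admissible_iff)
qed

section \<open>Closedness of the spectrum\<close>

text \<open>The norm bounds are independent of \<open>c\<close> and \<open>\<epsilon>\<close>: because no Mordell constant is below \<open>1/8\<close>,
  a rectangle with defect at most \<open>1/16\<close> still has area at least \<open>1/16\<close>.\<close>

lemma mordell_constant_normal_form:
  assumes "c \<in> MG2" "0 < \<epsilon>" "\<epsilon> \<le> 1/16"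
  obtains A B s where "\<bar>cross2 A B\<bar> = 1" "mordell_constant (lattice_of A B) = c"
    "admissible (lattice_of A B) s s" "c - \<epsilon> < s\<^sup>2" "s\<^sup>2 \<le> c" "norm A \<le> 6" "norm B \<le> 6"
    "1/8 \<le> c"
proof -
  obtain A0 B0 where det: "\<bar>cross2 A0 B0\<bar> = 1" and c: "c = mordell_constant (lattice_of A0 B0)"
    using \<open>c \<in> MG2\<close> by (auto simp: MG2_def unimodular_lattice_iff)
  obtain x0 y0 where xy0: "admissible (lattice_of A0 B0) x0 y0" "x0 * y0 \<ge> 1/8"
    using admissible_rectangle_of_area[OF det] .
  then have c8: "1/8 \<le> c"
    using admissible_area_le_mordell_constant[OF det xy0(1)] c by linarith
  have "c - \<epsilon> < Sup {x * y | x y. admissible (lattice_of A0 B0) x y}"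
    using \<open>\<epsilon> > 0\<close> c by (simp add: mordell_constant_def)
  then obtain x y where xy: "admissible (lattice_of A0 B0) x y" "c - \<epsilon> < x * y"
    using less_cSup_iff[OF _ bdd_above_admissible_areas[OF det]] xy0(1) by blast
  have area: "1/16 \<le> x * y" "x * y \<le> c"
    using xy c8 \<open>\<epsilon> \<le> 1/16\<close> admissible_area_le_mordell_constant[OF det xy(1)] c by linarith+
  obtain A B where AB: "\<bar>cross2 A B\<bar> = 1" "mordell_constant (lattice_of A B) = c"
    "admissible (lattice_of A B) (sqrt (x * y)) (sqrt (x * y))"
    "A \<bullet> A < 2" "x * y * (B \<bullet> B) \<le> 2"
    using square_normalization[OF det xy(1)] c by metis
  \<comment> \<open>The worst case is \<open>B \<bullet> B \<le> 2 \<cdot> 16 = 32\<close>, whence the norm bound 6.\<close>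
  have "1/16 * (B \<bullet> B) \<le> x * y * (B \<bullet> B)" using area by (intro mult_right_mono) auto
  then have "A \<bullet> A \<le> 6\<^sup>2" "B \<bullet> B \<le> 6\<^sup>2" using AB by auto
  then have "norm A \<le> 6" "norm B \<le> 6" by (auto simp: norm_le_square)
  moreover have "(sqrt (x * y))\<^sup>2 = x * y" using area by simp
  ultimately show ?thesis using that AB xy area c8 by metis
qed

theorem theorem36: "closed MG2"
  unfolding closed_sequential_limits
proof (intro allI impI, elim conjE)
  fix c :: "nat \<Rightarrow> real" and l
  assume mem: "\<forall>n. c n \<in> MG2" and lim: "c \<longlonglongrightarrow> l"
  \<comment> \<open>A vanishing defect that never exceeds \<open>1/16\<close>, half of the lower bound \<open>1/8\<close> for the spectrum.\<close>
  define \<epsilon> :: "nat \<Rightarrow> real" where "\<epsilon> n = 1 / 16 / Suc n" for n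
  have \<epsilon>: "0 < \<epsilon> n" "\<epsilon> n \<le> 1/16" for n by (auto simp: \<epsilon>_def field_simps)
  have \<epsilon>_lim: "\<epsilon> \<longlonglongrightarrow> 0"
    unfolding \<epsilon>_def using LIMSEQ_Suc[OF lim_const_over_n[of "1/16 :: real"]] by simp
  have "\<exists>A B s. \<bar>cross2 A B\<bar> = 1 \<and> mordell_constant (lattice_of A B) = c n \<and>
      admissible (lattice_of A B) s s \<and> c n - \<epsilon> n < s\<^sup>2 \<and> s\<^sup>2 \<le> c n \<and>
      norm A \<le> 6 \<and> norm B \<le> 6 \<and> 1/8 \<le> c n" for n
    using mordell_constant_normal_form[OF mem[rule_format, of n] \<epsilon>[of n]] by metis
  then obtain A B s where ABs: "\<And>n. \<bar>cross2 (A n) (B n)\<bar> = 1"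
    "\<And>n. mordell_constant (lattice_of (A n) (B n)) = c n"
    "\<And>n. admissible (lattice_of (A n) (B n)) (s n) (s n)"
    "\<And>n. c n - \<epsilon> n < (s n)\<^sup>2" "\<And>n. (s n)\<^sup>2 \<le> c n"
    "\<And>n. norm (A n) \<le> 6" "\<And>n. norm (B n) \<le> 6" "\<And>n. 1/8 \<le> c n"
    by metis
  have l8: "1/8 \<le> l" using lim ABs(8) by (intro LIMSEQ_le_const) auto
  have "(\<lambda>n. (s n)\<^sup>2) \<longlonglongrightarrow> l"
  proof (rule tendsto_sandwich[OF _ _ _ lim])
    show "(\<lambda>n. c n - \<epsilon> n) \<longlonglongrightarrow> l" using tendsto_diff[OF lim \<epsilon>_lim] by simp
  qed (intro always_eventually allI less_imp_le ABs(4) ABs(5))+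
  then have "(\<lambda>n. sqrt ((s n)\<^sup>2)) \<longlonglongrightarrow> sqrt l" by (rule tendsto_real_sqrt)
  moreover have "s n > 0" for n using ABs(3)[of n] by (simp add: admissible_def)
  ultimately have s_lim: "s \<longlonglongrightarrow> sqrt l" by (simp add: less_imp_le)
  \<comment> \<open>A simultaneous limit of both basis vectors comes from compactness of a product of balls.\<close>
  have "compact (cball (0 :: real^2) 6 \<times> cball (0 :: real^2) 6)" by (intro compact_Times) auto
  then obtain L r where r: "strict_mono r" and L: "((\<lambda>n. (A n, B n)) \<circ> r) \<longlonglongrightarrow> L"
    unfolding compact_def using ABs(6,7) by (metis (no_types, lifting) SigmaI mem_cball_0)
  define A' B' where "A' = fst L" and "B' = snd L"
  have lims: "(A \<circ> r) \<longlonglongrightarrow> A'" "(B \<circ> r) \<longlonglongrightarrow> B'" "(s \<circ> r) \<longlonglongrightarrow> sqrt l" "(c \<circ> r) \<longlonglongrightarrow> l"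
    using tendsto_fst[OF L] tendsto_snd[OF L] LIMSEQ_subseq_LIMSEQ[OF s_lim r]
      LIMSEQ_subseq_LIMSEQ[OF lim r] by (simp_all add: A'_def B'_def o_def)
  have "(\<lambda>k. \<bar>cross2 ((A \<circ> r) k) ((B \<circ> r) k)\<bar>) \<longlonglongrightarrow> \<bar>cross2 A' B'\<bar>"
    by (intro tendsto_rabs tendsto_cross2 lims)
  then have "(\<lambda>k. 1 :: real) \<longlonglongrightarrow> \<bar>cross2 A' B'\<bar>" by (simp add: ABs(1))
  then have det: "\<bar>cross2 A' B'\<bar> = 1" by (metis LIMSEQ_unique tendsto_const)
  have "mordell_constant (lattice_of A' B') \<le> l"
    unfolding mordell_constant_def
  proof (rule cSup_least)
    show "{x * y | x y. admissible (lattice_of A' B') x y} \<noteq> {}"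
      using admissible_rectangle_of_area[OF det] by blast
  next
    fix z assume "z \<in> {x * y | x y. admissible (lattice_of A' B') x y}"
    then obtain x y where z: "z = x * y" and "admissible (lattice_of A' B') x y" by auto
    then have "\<forall>\<^sub>F k in sequentially. admissible (lattice_of ((A \<circ> r) k) ((B \<circ> r) k)) x y"
      using ABs(1,6,7) by (intro eventually_admissible[OF lims(1,2) _ det, of 6]) auto
    then have "\<forall>\<^sub>F k in sequentially. z \<le> (c \<circ> r) k"
      by eventually_elim (metis ABs(1,2) admissible_area_le_mordell_constant comp_apply z)
    then show "z \<le> l" by (rule tendsto_lowerbound[OF lims(4)]) simp
  qed
  moreover have "l \<le> mordell_constant (lattice_of A' B')"
  proof (rule ccontr)
    assume "\<not> ?thesis"
    then have less: "mordell_constant (lattice_of A' B') < l" by simp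
    define q where "q = (max 0 (mordell_constant (lattice_of A' B')) + l) / 2"
    have q: "0 < q" "mordell_constant (lattice_of A' B') < q" "q < l"
      using less l8 by (auto simp: q_def)
    have "admissible (lattice_of A' B') (sqrt q) (sqrt q)"
      using ABs(1,3) q by (intro admissible_square_limit[OF lims(1,2) _ _ lims(3)]) auto
    then show False using admissible_area_le_mordell_constant[OF det] q by fastforce
  qed
  ultimately have "l = mordell_constant (lattice_of A' B')" by simp
  then show "l \<in> MG2" using det unfolding MG2_def unimodular_lattice_iff by blast
qed

end
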